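(* Let $\rho\in(0,1)$, let $R_0\ge1$ be an integer, let $T_0:=R_0W$, let $\mathcal G_{R_0}:=\{D(R_0)=0\}$, and assume $$\Pr(\mathcal G_{R_0})\ge 1-\rho .$$ Let $\eta\in(0,1]$ be the constant tracking gain used from time $T_0$ on. Assume bounded drift: there is a constant $\nu\ge0$ such that, on the event $\mathcal G_{R_0}$, $$\|x_a^\star(t+1)-x_a^\star(t)\|\le\nu\qquad\text{for all } t\ge T_0,$$ where $t=T_0,T_0+1,\dots$ are the relabeled informative times. Then, on the event $\mathcal G_{R_0}$, the informative-step tracking error $e_t:=\hat x_t-x_a^\star(t)$ satisfies, for every $t\ge T_0$, $$\|e_{t+1}\|^2\le(1-\eta)\|e_t\|^2+\frac{\nu^2}{\eta}.$$ Consequently, $$\limsup_{t\to\infty}\mathbb E\!\left[\|e_t\|^2\,\middle|\,\mathcal G_{R_0}\right]\le\frac{\nu^2}{\eta^2}.$$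
   Context: Agents and activity. There is a finite set of agents $\mathcal N=\{1,\dots,N\}$ and a fixed nonempty subset $\mathcal X\subset\mathcal N$ of persistent agents. Time is discrete, $t=0,1,2,\dots$. For each agent $i$, the activity indicators $\{s_i(t)\}_{t\ge0}$, with values in $\{0,1\}$, are i.i.d. Bernoulli with parameter $p_i\in(0,1]$. The active set is $\mathcal A_t:=\{i\in\mathcal N:s_i(t)=1\}$. Each agent has a real-valued signal $x_i(t)\in\mathbb R$, $t\ge 0$, revealed to the server only when agent $i$ is active. The norm $\|\cdot\|$ is the absolute value on $\mathbb R$. Identification. Fix a window length $W\ge1$, an integer threshold $k^\star\in\{1,\dots,W\}$ and $\lambda\in(0,1)$. For $r=1,2,\dots$ let $K_{i,r}:=\sum_{u=0}^{W-1}s_i((r-1)W+u)$, $b_{i,r}:=\mathbf 1\{K_{i,r}\ge k^\star\}$, and for $R\ge 1$ let $C_i(R):=\frac1R\sum_{r=1}^Rb_{i,r}$ and $\widehat{\mathcal X}(R):=\{i\in\mathcal N:C_i(R)\ge\lambda\}$; set $\widehat{\mathcal X}(0):=\emptyset$. Let $D(R):=\sum_{i\in\mathcal N}|\mathbf 1\{C_i(R)\ge\lambda\}-\mathbf 1\{i\in\mathcal X\}|$ be the number of misclassified agents; $D(R)=0$ if and only if $\widehat{\mathcal X}(R)=\mathcal X$. Tracking. The server keeps an estimate $\hat x_t\in\mathbb R$, started at some $\hat x_0\in\mathbb R$. At each time $t$ it uses an eligible set $\mathcal E(t)$, where $\mathcal E(t):=\widehat{\mathcal X}(\lfloor t/W\rfloor)\cap\mathcal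 A_t$ for $t<T_0$, and the set estimate is frozen from time $T_0$ on: $\mathcal E(t):=\widehat{\mathcal X}(R_0)\cap\mathcal A_t$ for $t\ge T_0$. It sets $$\tilde x(t):=\frac1{|\mathcal E(t)|}\sum_{\ell\in\mathcal E(t)}x_\ell(t)\ \text{ if }|\mathcal E(t)|>0,\qquad \tilde x(t):=\hat x_t\ \text{ if }|\mathcal E(t)|=0,$$ and updates $\hat x_{t+1}=(1-\eta_t)\hat x_t+\eta_t\tilde x(t)$ with given gains $\eta_t\in(0,1]$, where $\eta_t=\eta$ is constant for $t\ge T_0$. Target and informative times. The active persistent mean is $$x_a^\star(t):=\frac{1}{|\mathcal X\cap\mathcal A_t|}\sum_{i\in\mathcal X\cap\mathcal A_t}x_i(t),$$ defined when $\mathcal X\cap\mathcal A_t\ne\emptyset$. The informative times are those times at or after $T_0$ for which $|\mathcal E(t)|>0$; listed in increasing order, they are relabeled $t=T_0,T_0+1,T_0+2,\dots$, and in the claim all quantities $\hat x_t$, $x_a^\star(t)$, $\tilde x(t)$, $e_t$ for $t\ge T_0$ are indexed by these relabeled informative times (the estimate does not change between consecutive informative times, so $\hat x_{t+1}=(1-\eta)\hat x_t+\eta\tilde x(t)$ holds in the relabeled index).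
   Formalization: The limsup bound is proved unconditionally for non-random signals; if the signals x_i(t) are random it additionally assumes that E[|e_{T_0}|^2 | G_{R_0}] is finite, since otherwise it can fail (e.g. x_1(t)=Z with infinite second moment, ν=0, gains below 1). *)

theory Defs
  imports "HOL-Probability.Probability"
begin

text \<open>
  Everything here is a function of one sample path: \<open>s i t\<close> is the realised activity indicator
  (0 or 1) and \<open>x i t\<close> the realised signal of agent \<open>i\<close> at time \<open>t\<close>.
  The agents are \<open>{1..N}\<close>, the set of persistent agents is \<open>X\<close>.
\<close>

definition active :: "nat \<Rightarrow> (nat \<Rightarrow> nat \<Rightarrow> nat) \<Rightarrow> nat \<Rightarrow> nat set" where
  "active N s t = {i \<in> {1..N}. s i t = 1}"


subsection \<open>Identification\<close>

definition block_count :: "nat \<Rightarrow> (nat \<Rightarrow> nat \<Rightarrow> nat) \<Rightarrow> nat \<Rightarrow> nat \<Rightarrow> nat" where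
  "block_count W s i r = (\<Sum>u<W. s i ((r - 1) * W + u))"

definition block_pass :: "nat \<Rightarrow> nat \<Rightarrow> (nat \<Rightarrow> nat \<Rightarrow> nat) \<Rightarrow> nat \<Rightarrow> nat \<Rightarrow> real" where
  "block_pass W k s i r = of_bool (block_count W s i r \<ge> k)"

definition score :: "nat \<Rightarrow> nat \<Rightarrow> (nat \<Rightarrow> nat \<Rightarrow> nat) \<Rightarrow> nat \<Rightarrow> nat \<Rightarrow> real" where
  "score W k s i R = (1 / real R) * (\<Sum>r=1..R. block_pass W k s i r)"

definition est_set ::
  "nat \<Rightarrow> nat \<Rightarrow> nat \<Rightarrow> real \<Rightarrow> (nat \<Rightarrow> nat \<Rightarrow> nat) \<Rightarrow> nat \<Rightarrow> nat set" where
  "est_set N W k lam s R = (if R = 0 then {} else {i \<in> {1..N}. score W k s i R \<ge> lam})"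

definition misclassified ::
  "nat \<Rightarrow> nat set \<Rightarrow> nat \<Rightarrow> nat \<Rightarrow> real \<Rightarrow> (nat \<Rightarrow> nat \<Rightarrow> nat) \<Rightarrow> nat \<Rightarrow> int" where
  "misclassified N X W k lam s R =
     (\<Sum>i\<in>{1..N}. \<bar>of_bool (score W k s i R \<ge> lam) - of_bool (i \<in> X)\<bar>)"


subsection \<open>Tracking\<close>

definition eligible ::
  "nat \<Rightarrow> nat \<Rightarrow> nat \<Rightarrow> real \<Rightarrow> nat \<Rightarrow> (nat \<Rightarrow> nat \<Rightarrow> nat) \<Rightarrow> nat \<Rightarrow> nat set" where
  "eligible N W k lam R0 s t =
     (if t < R0 * W then est_set N W k lam s (t div W) else est_set N W k lam s R0) \<inter> active N s t"

definition mean_over :: "nat set \<Rightarrow> (nat \<Rightarrow> real) \<Rightarrow> real" where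
  "mean_over A f = (1 / real (card A)) * (\<Sum>i\<in>A. f i)"

text \<open>
  The server estimate in real time, for a process \<open>E\<close> of eligible sets, gains \<open>g\<close> and initial
  value \<open>x0\<close>.
\<close>

primrec estimate ::
  "(nat \<Rightarrow> nat set) \<Rightarrow> (nat \<Rightarrow> nat \<Rightarrow> real) \<Rightarrow> (nat \<Rightarrow> real) \<Rightarrow> real \<Rightarrow> nat \<Rightarrow> real" where
  "estimate E x g x0 0 = x0"
| "estimate E x g x0 (Suc t) =
     (1 - g t) * estimate E x g x0 t
     + g t * (if card (E t) > 0 then mean_over (E t) (\<lambda>i. x i t) else estimate E x g x0 t)"


subsection \<open>Informative times\<close>

definition informative_times :: "(nat \<Rightarrow> nat set) \<Rightarrow> nat \<Rightarrow> nat set" where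
  "informative_times E T0 = {t. t \<ge> T0 \<and> card (E t) > 0}"

text \<open>
  The real time carrying the label \<open>t \<ge> T0\<close>. On a sample path with only finitely many informative
  times, \<open>informative_time E T0 t\<close> is meaningful only if \<open>has_label E T0 t\<close> holds.
\<close>

definition informative_time :: "(nat \<Rightarrow> nat set) \<Rightarrow> nat \<Rightarrow> nat \<Rightarrow> nat" where
  "informative_time E T0 t = enumerate (informative_times E T0) (t - T0)"

definition has_label :: "(nat \<Rightarrow> nat set) \<Rightarrow> nat \<Rightarrow> nat \<Rightarrow> bool" where
  "has_label E T0 t \<longleftrightarrow>
     t \<ge> T0 \<and> (infinite (informative_times E T0) \<or> t - T0 < card (informative_times E T0))"

end

theory Submission
  imports Defs
begin

text \<open>
  On the event \<open>G\<close> the final set estimate is exactly \<open>X\<close>, so from time \<open>T0\<close> on the server averages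
  over the active persistent agents and its input at an informative time is the target itself.
  Along the labelled informative times the error therefore satisfies
  \<open>e (t + 1) = (1 - \<eta>) * e t - (xa (t + 1) - xa t)\<close>. Writing the drift as \<open>\<eta>\<close> times its quotient by
  \<open>\<eta>\<close>, convexity of the square gives the one-step bound (\<open>square_contraction_with_drift\<close>). Iterating
  it bounds the \<open>n\<close>-th squared error by \<open>(1 - \<eta>) ^ n\<close> times the first one plus \<open>\<nu>\<^sup>2 / \<eta>\<^sup>2\<close>, and the
  limit superior follows as soon as the first squared error has finite mean given \<open>G\<close>
  (\<open>limsup_of_contraction\<close>).

  For deterministic signals this finiteness has to be proved, and it is the hard part. The first
  informative time is unbounded and a signal may grow without bound over time, so \<open>xa T0\<close> may take
  arbitrarily large values. What tames it is that the drift bound holds on all of \<open>G\<close> and the signals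
  are the same on all paths: two paths of \<open>G\<close> on which the same agents are active at a common time
  have the same target value there. If on a set \<open>H\<close> of paths \<open>xa T0\<close> is much larger than on a
  reference set, then for many times the active sets seen on \<open>H\<close> must differ from those seen on the
  reference set. Activity of different agents may be coupled in any way, so this alone is no
  contradiction; but each agent has its own prescribed activity rate \<open>p i\<close>. Call a family of active
  sets balanced if the rate vector \<open>p\<close> passes every linear test that all members of the family pass.
  If the families of \<open>H\<close> and of the reference set are both balanced at one time, then the target
  levels on both are comparable with the same number, the \<open>p\<close>-weighted mean of the signals
  (\<open>upper_level_linked\<close>). If a family is unbalanced at \<open>m\<close> times, then some agent deviates from its rate
  by an amount of order \<open>m\<close>, which by Hoeffding's inequality has probability exponentially small in
  \<open>m\<close> (\<open>unbalanced_concentration\<close>). Hence \<open>xa T0\<close> has exponential tails on \<open>G\<close> and a finite second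
  moment. The same concentration bound shows that almost surely there are infinitely many
  informative times, so that almost surely every label is attained.
\<close>

section \<open>Labelled informative times\<close>

lemma estimate_constant_between:
  assumes "u \<le> v" "\<And>t. u \<le> t \<Longrightarrow> t < v \<Longrightarrow> card (E t) = 0"
  shows "estimate E x g x0 v = estimate E x g x0 u"
  using assms
proof (induction v rule: dec_induct)
  case (step n)
  then have "card (E n) = 0" by simp
  then show ?case using step by (simp add: algebra_simps)
qed simp

lemma informative_time_in:
  assumes "has_label E T0 t"
  shows "informative_time E T0 t \<in> informative_times E T0"
proof (cases "finite (informative_times E T0)")
  case True
  then show ?thesis
    using assms by (auto simp: has_label_def informative_time_def intro!: finite_enumerate_in_set)
next
  case False
  then show ?thesis
    by (auto simp: informative_time_def intro!: enumerate_in_set)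
qed

lemma has_label_pred: "has_label E T0 (t + 1) \<Longrightarrow> T0 \<le> t \<Longrightarrow> has_label E T0 t"
  by (auto simp: has_label_def)

lemma informative_time_Suc:
  assumes "T0 \<le> t" "has_label E T0 (t + 1)"
  shows "informative_time E T0 (t + 1) =
    (LEAST v. v \<in> informative_times E T0 \<and> informative_time E T0 t < v)"
proof -
  have eq: "t + 1 - T0 = Suc (t - T0)" using assms(1) by simp
  show ?thesis
  proof (cases "finite (informative_times E T0)")
    case True
    then show ?thesis
      using assms unfolding informative_time_def eq
      by (intro finite_enumerate_Suc'') (auto simp: has_label_def eq)
  next
    case False
    then show ?thesis
      unfolding informative_time_def eq by (intro enumerate_Suc'')
  qed
qed

lemma informative_time_less_Suc:
  assumes "T0 \<le> t" "has_label E T0 (t + 1)"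
  shows "informative_time E T0 t < informative_time E T0 (t + 1)"
proof -
  have eq: "t + 1 - T0 = Suc (t - T0)" using assms(1) by simp
  show ?thesis
    using assms unfolding informative_time_def eq has_label_def
    by (cases "finite (informative_times E T0)") (auto intro: enumerate_step finite_enumerate_step)
qed

lemma uninformative_between:
  assumes "T0 \<le> t" "has_label E T0 (t + 1)"
    and "informative_time E T0 t < v" "v < informative_time E T0 (t + 1)"
  shows "card (E v) = 0"
proof (rule ccontr)
  assume "card (E v) \<noteq> 0"
  moreover have "T0 \<le> informative_time E T0 t"
    using informative_time_in[OF has_label_pred[OF assms(2,1)]] by (simp add: informative_times_def)
  ultimately have "v \<in> informative_times E T0"
    using assms(3) by (simp add: informative_times_def)
  then have "informative_time E T0 (t + 1) \<le> v"
    unfolding informative_time_Suc[OF assms(1,2)] using assms(3) by (intro Least_le) simp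
  with assms(4) show False by simp
qed

text \<open>
  A label never exceeds the time that carries it. This turns a drift bound per label into a drift
  bound per unit of time, which is what paths with different informative times have in common.
\<close>

lemma le_informative_time:
  assumes "has_label E T0 t"
  shows "t \<le> informative_time E T0 t"
proof -
  have "T0 \<le> t" using assms by (simp add: has_label_def)
  then show ?thesis using assms
  proof (induction t rule: dec_induct)
    case base
    then show ?case using informative_time_in[OF base] by (simp add: informative_times_def)
  next
    case (step n)
    then have "n \<le> informative_time E T0 n" using has_label_pred[of E T0 n] by simp
    moreover have "informative_time E T0 n < informative_time E T0 (n + 1)"
      using step by (intro informative_time_less_Suc) auto
    ultimately show ?case by simp
  qed
qed

lemma informative_time_label:
  assumes "u \<in> informative_times E T0"
  obtains t where "has_label E T0 t" "informative_time E T0 t = u"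
proof -
  obtain n where n: "enumerate (informative_times E T0) n = u"
      "infinite (informative_times E T0) \<or> n < card (informative_times E T0)"
    using enumerate_Ex[of "informative_times E T0" u]
      finite_enumerate_Ex[of "informative_times E T0" u] assms by blast
  show ?thesis
    by (rule that[of "T0 + n"]) (use n in \<open>auto simp: has_label_def informative_time_def\<close>)
qed

text \<open>
  Between two consecutive informative times the estimate stands still, so the update rule holds in
  the labelled index.
\<close>

lemma estimate_next_informative:
  fixes x :: "nat \<Rightarrow> nat \<Rightarrow> real" and g :: "nat \<Rightarrow> real" and E T0 x0
  defines "est \<equiv> estimate E x g x0" and "u \<equiv> informative_time E T0"
  assumes "T0 \<le> t" "has_label E T0 (t + 1)"
  shows "est (u (t + 1)) = (1 - g (u t)) * est (u t) + g (u t) * mean_over (E (u t)) (\<lambda>i. x i (u t))"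
proof -
  have "est (u (t + 1)) = est (Suc (u t))"
    unfolding est_def
    using informative_time_less_Suc[OF assms(3,4)] uninformative_between[OF assms(3,4)]
    by (intro estimate_constant_between) (auto simp: u_def)
  moreover have "card (E (u t)) > 0"
    using informative_time_in[OF has_label_pred[OF assms(4,3)]]
    by (simp add: informative_times_def u_def)
  ultimately show ?thesis by (simp add: est_def)
qed

lemma estimate_first_informative:
  assumes "has_label E T0 T0"
  shows "estimate E x g x0 (informative_time E T0 T0) = estimate E x g x0 T0"
proof (rule estimate_constant_between)
  show "T0 \<le> informative_time E T0 T0" using le_informative_time[OF assms] .
  fix t assume t: "T0 \<le> t" "t < informative_time E T0 T0"
  then show "card (E t) = 0"
    using not_less_Least[of t "\<lambda>v. v \<in> informative_times E T0"]
    by (auto simp: informative_time_def enumerate_0 informative_times_def)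
qed

section \<open>Contraction with bounded drift\<close>

text \<open>
  Convexity of the square, as \<open>(1 - \<eta>) * a - d = (1 - \<eta>) * a + \<eta> * (- d / \<eta>)\<close>. The proof writes the
  defect in this inequality as an explicit square.
\<close>

lemma square_contraction_with_drift:
  fixes a d \<eta> \<nu> :: real
  assumes "0 < \<eta>" "\<eta> \<le> 1" "\<bar>d\<bar> \<le> \<nu>"
  shows "\<bar>(1 - \<eta>) * a - d\<bar>\<^sup>2 \<le> (1 - \<eta>) * \<bar>a\<bar>\<^sup>2 + \<nu>\<^sup>2 / \<eta>"
proof -
  \<comment> \<open>The subtracted term is the convexity defect.\<close>
  have "\<eta> * ((1 - \<eta>) * a - d)\<^sup>2 = \<eta> * ((1 - \<eta>) * a\<^sup>2) + d\<^sup>2 - (1 - \<eta>) * (\<eta> * a + d)\<^sup>2"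
    by (simp add: power2_eq_square algebra_simps)
  also have "\<dots> \<le> \<eta> * ((1 - \<eta>) * a\<^sup>2) + d\<^sup>2"
    using assms by simp
  also have "d\<^sup>2 \<le> \<nu>\<^sup>2"
    using assms by (simp add: abs_le_square_iff[symmetric])
  finally show ?thesis
    using assms by (simp add: field_simps)
qed

lemma contraction_iterate:
  fixes a :: "nat \<Rightarrow> real"
  assumes "\<eta> \<le> 1" and step: "\<And>n. a (Suc n) \<le> (1 - \<eta>) * a n + \<eta> * b"
  shows "a n \<le> (1 - \<eta>) ^ n * a 0 + (1 - (1 - \<eta>) ^ n) * b"
proof (induction n)
  case (Suc n)
  have "a (Suc n) \<le> (1 - \<eta>) * a n + \<eta> * b" by (rule step)
  also have "\<dots> \<le> (1 - \<eta>) * ((1 - \<eta>) ^ n * a 0 + (1 - (1 - \<eta>) ^ n) * b) + \<eta> * b"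
    using Suc assms by (intro add_right_mono mult_left_mono) auto
  finally show ?case by (simp add: algebra_simps)
qed simp

text \<open>
  Iterating the inequality pointwise before integrating leaves only the initial function \<open>a 0\<close> to be
  measurable and integrable.
\<close>

lemma (in prob_space) limsup_of_contraction:
  fixes a :: "nat \<Rightarrow> 'a \<Rightarrow> real"
  assumes \<eta>: "0 < \<eta>" "\<eta> \<le> 1" and "0 \<le> b"
    and [measurable]: "a 0 \<in> borel_measurable M" and fin: "(\<integral>\<^sup>+\<omega>. ennreal (a 0 \<omega>) \<partial>M) < \<infinity>"
    and nonneg: "\<And>\<omega>. 0 \<le> a 0 \<omega>"
    and step: "AE \<omega> in M. \<forall>n. a (Suc n) \<omega> \<le> (1 - \<eta>) * a n \<omega> + \<eta> * b"
  shows "limsup (\<lambda>n. \<integral>\<^sup>+\<omega>. ennreal (a n \<omega>) \<partial>M) \<le> ennreal b"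
proof -
  define v where "v = enn2real (\<integral>\<^sup>+\<omega>. ennreal (a 0 \<omega>) \<partial>M)"
  have v: "(\<integral>\<^sup>+\<omega>. ennreal (a 0 \<omega>) \<partial>M) = ennreal v" "0 \<le> v"
    using fin by (simp_all add: v_def)
  have le: "(\<integral>\<^sup>+\<omega>. ennreal (a n \<omega>) \<partial>M) \<le> ennreal ((1 - \<eta>) ^ n * v + b)" for n
  proof -
    have "AE \<omega> in M. ennreal (a n \<omega>) \<le> ennreal ((1 - \<eta>) ^ n) * ennreal (a 0 \<omega>) + ennreal b"
    proof (rule AE_mp[OF step], rule AE_I2, rule impI)
      fix \<omega> assume "\<forall>n. a (Suc n) \<omega> \<le> (1 - \<eta>) * a n \<omega> + \<eta> * b"
      then have "a n \<omega> \<le> (1 - \<eta>) ^ n * a 0 \<omega> + (1 - (1 - \<eta>) ^ n) * b"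
        using \<eta> by (intro contraction_iterate[of \<eta> "\<lambda>n. a n \<omega>"]) auto
      also have "\<dots> \<le> (1 - \<eta>) ^ n * a 0 \<omega> + b"
        using \<eta> \<open>0 \<le> b\<close> by (simp add: algebra_simps)
      finally show "ennreal (a n \<omega>) \<le> ennreal ((1 - \<eta>) ^ n) * ennreal (a 0 \<omega>) + ennreal b"
        using \<eta> \<open>0 \<le> b\<close> nonneg[of \<omega>]
        by (simp add: ennreal_mult[symmetric] ennreal_plus[symmetric] ennreal_leI del: ennreal_plus)
    qed
    then have "(\<integral>\<^sup>+\<omega>. ennreal (a n \<omega>) \<partial>M) \<le> (\<integral>\<^sup>+\<omega>. ennreal ((1 - \<eta>) ^ n) * ennreal (a 0 \<omega>) + ennreal b \<partial>M)"
      by (rule nn_integral_mono_AE)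
    also have "\<dots> = ennreal ((1 - \<eta>) ^ n) * ennreal v + ennreal b"
      by (simp add: nn_integral_add nn_integral_cmult v emeasure_space_1)
    also have "\<dots> = ennreal ((1 - \<eta>) ^ n * v + b)"
      using \<eta> \<open>0 \<le> b\<close> v(2) by (simp add: ennreal_mult)
    finally show ?thesis .
  qed
  have "(\<lambda>n. ennreal ((1 - \<eta>) ^ n * v + b)) \<longlonglongrightarrow> ennreal (0 * v + b)"
    using \<eta> by (intro tendsto_intros tendsto_ennrealI LIMSEQ_realpow_zero) auto
  then have "limsup (\<lambda>n. ennreal ((1 - \<eta>) ^ n * v + b)) = ennreal b"
    by (intro lim_imp_Limsup) auto
  moreover have "limsup (\<lambda>n. \<integral>\<^sup>+\<omega>. ennreal (a n \<omega>) \<partial>M) \<le> limsup (\<lambda>n. ennreal ((1 - \<eta>) ^ n * v + b))"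
    by (intro Limsup_mono always_eventually allI le)
  ultimately show ?thesis by simp
qed

section \<open>Balanced families of active sets\<close>

text \<open>
  By Farkas' lemma, for a finite family \<open>F\<close> of finite subsets of \<open>X\<close> this says that the vector \<open>p\<close> is a
  nonnegative combination of the indicator vectors of the members of \<open>F\<close>, as it must be if the sets
  active at one time range over \<open>F\<close> and each agent \<open>i\<close> is active with probability \<open>p i\<close>. The dual form
  is chosen because its negation directly supplies a test vector.
\<close>

definition balanced :: "('i \<Rightarrow> real) \<Rightarrow> 'i set \<Rightarrow> 'i set set \<Rightarrow> bool" where
  "balanced p X F \<longleftrightarrow> (\<forall>a. (\<forall>B\<in>F. 0 \<le> sum a B) \<longrightarrow> 0 \<le> (\<Sum>i\<in>X. p i * a i))"

text \<open>
  A finite set has only finitely many families of subsets. Hence one \<open>\<delta>\<close> works for all unbalanced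
  families, once their test vectors are scaled to entries of absolute value at most 1. Without this
  uniformity the deviations found at different times could not be added up.
\<close>

lemma uniform_unbalance:
  fixes p :: "'i \<Rightarrow> real"
  assumes "finite X"
  obtains \<delta> where "\<delta> > 0"
    and "\<And>F. F \<subseteq> Pow X \<Longrightarrow> \<not> balanced p X F \<Longrightarrow>
      \<exists>a. (\<forall>i\<in>X. \<bar>a i\<bar> \<le> 1) \<and> (\<forall>B\<in>F. 0 \<le> sum a B) \<and> (\<Sum>i\<in>X. p i * a i) \<le> - \<delta>"
proof -
  define \<F> where "\<F> = {F. F \<subseteq> Pow X \<and> \<not> balanced p X F}"
  have fin: "finite \<F>" unfolding \<F>_def using assms by simp
  have "\<exists>a. (\<forall>i\<in>X. \<bar>a i\<bar> \<le> 1) \<and> (\<forall>B\<in>F. 0 \<le> sum a B) \<and> (\<Sum>i\<in>X. p i * a i) < 0"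
    if F: "F \<in> \<F>" for F
  proof -
    obtain a where a: "\<And>B. B \<in> F \<Longrightarrow> 0 \<le> sum a B" "(\<Sum>i\<in>X. p i * a i) < 0"
      using F by (auto simp: \<F>_def balanced_def not_le)
    define n where "n = (\<Sum>i\<in>X. \<bar>a i\<bar>)"
    have le: "\<bar>a i\<bar> \<le> n" if "i \<in> X" for i
      unfolding n_def using assms that by (intro member_le_sum) auto
    obtain j where "j \<in> X" "a j \<noteq> 0"
      using a(2) sum.neutral[of X "\<lambda>i. p i * a i"] by fastforce
    with le[of j] have n: "n > 0" by auto
    show ?thesis
      by (rule exI[of _ "\<lambda>i. a i / n"])
        (use n le a in \<open>auto simp: sum_divide_distrib[symmetric] divide_le_0_iff divide_less_0_iff\<close>)
  qed
  then obtain a where a: "\<And>F i. F \<in> \<F> \<Longrightarrow> i \<in> X \<Longrightarrow> \<bar>a F i\<bar> \<le> 1"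
    "\<And>F B. F \<in> \<F> \<Longrightarrow> B \<in> F \<Longrightarrow> 0 \<le> sum (a F) B"
    "\<And>F. F \<in> \<F> \<Longrightarrow> (\<Sum>i\<in>X. p i * a F i) < 0"
    by metis
  \<comment> \<open>The element 1 keeps the minimum meaningful if every family is balanced.\<close>
  define \<delta> where "\<delta> = Min (insert 1 ((\<lambda>F. - (\<Sum>i\<in>X. p i * a F i)) ` \<F>))"
  have "\<delta> > 0" unfolding \<delta>_def using fin a(3) by simp
  moreover have "(\<Sum>i\<in>X. p i * a F i) \<le> - \<delta>" if "F \<in> \<F>" for F
  proof -
    have "\<delta> \<le> - (\<Sum>i\<in>X. p i * a F i)" unfolding \<delta>_def using fin that by (intro Min_le) auto
    then show ?thesis by simp
  qed
  moreover have "F \<in> \<F>" if "F \<subseteq> Pow X" "\<not> balanced p X F" for F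
    using that by (simp add: \<F>_def)
  ultimately show ?thesis using a(1,2) by (intro that[of \<delta>]) blast+
qed

text \<open>
  If the mean of \<open>y\<close> over each nonempty member is at least \<open>L\<close>, then \<open>y - L\<close> is a test vector that all
  members pass; a balanced family passes the test on to \<open>p\<close>. The number on the right depends on
  neither the family nor \<open>L\<close>, which makes levels on different families comparable.
\<close>

lemma balanced_mean_ge:
  assumes "finite X" "balanced p X F"
    and F: "\<And>B. B \<in> F \<Longrightarrow> B \<subseteq> X" "\<And>B. B \<in> F \<Longrightarrow> B \<noteq> {} \<Longrightarrow> L \<le> mean_over B y"
  shows "L * sum p X \<le> (\<Sum>i\<in>X. p i * y i)"
proof -
  have "0 \<le> (\<Sum>i\<in>B. y i - L)" if B: "B \<in> F" for B
  proof (cases "B = {}")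
    case False
    have "card B > 0" using False F(1)[OF B] assms(1) by (simp add: card_gt_0_iff finite_subset)
    then have "L * card B \<le> sum y B"
      using F(2)[OF B False] by (simp add: mean_over_def field_simps)
    then show ?thesis by (simp add: sum_subtractf mult.commute)
  qed simp
  then have "0 \<le> (\<Sum>i\<in>X. p i * (y i - L))"
    using assms(2)[unfolded balanced_def, rule_format, of "\<lambda>i. y i - L"] by blast
  then show ?thesis by (simp add: algebra_simps sum_subtractf sum_distrib_left)
qed

lemma mean_over_minus: "mean_over B (\<lambda>i. - y i) = - mean_over B y"
  by (simp add: mean_over_def sum_negf)

section \<open>Concentration for coupled agents\<close>

text \<open>
  For each single agent the activity is independent over time; nothing is assumed about the joint
  behaviour of different agents, whose activities may be arbitrarily coupled.
\<close>

locale activity = prob_space M for M :: "'w measure" +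
  fixes X :: "nat set" and p :: "nat \<Rightarrow> real" and s :: "nat \<Rightarrow> nat \<Rightarrow> 'w \<Rightarrow> nat"
  assumes finite_agents: "finite X" and agents_nonempty: "X \<noteq> {}"
    and p_pos: "\<And>i. i \<in> X \<Longrightarrow> 0 < p i"
    and s_01: "\<And>i t \<omega>. i \<in> X \<Longrightarrow> \<omega> \<in> space M \<Longrightarrow> s i t \<omega> \<in> {0, 1}"
    and s_indep: "\<And>i. i \<in> X \<Longrightarrow> indep_vars (\<lambda>_. count_space UNIV) (s i) UNIV"
    and s_prob: "\<And>i t. i \<in> X \<Longrightarrow> prob {\<omega> \<in> space M. s i t \<omega> = 1} = p i"
begin

definition awake :: "nat \<Rightarrow> 'w \<Rightarrow> nat set" where
  "awake t \<omega> = {i \<in> X. s i t \<omega> = 1}"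

lemma awake_subset: "awake t \<omega> \<subseteq> X"
  by (auto simp: awake_def)

lemma s_measurable [measurable (raw)]: "i \<in> X \<Longrightarrow> s i t \<in> measurable M (count_space UNIV)"
  using s_indep[of i] unfolding indep_vars_def by auto

lemma expectation_s:
  assumes "i \<in> X"
  shows "expectation (\<lambda>\<omega>. real (s i t \<omega>)) = p i"
proof -
  have [measurable]: "s i t \<in> measurable M (count_space UNIV)" using assms by simp
  have "expectation (\<lambda>\<omega>. real (s i t \<omega>)) = expectation (indicator {\<omega> \<in> space M. s i t \<omega> = 1})"
    using s_01[OF assms] by (intro Bochner_Integration.integral_cong) (force simp: indicator_def)+
  also have "\<dots> = p i" using s_prob[OF assms, of t] by simp
  finally show ?thesis .
qed

lemma weighted_sum_awake:
  assumes "\<omega> \<in> space M"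
  shows "(\<Sum>i\<in>X. a i * real (s i t \<omega>)) = sum a (awake t \<omega>)"
proof -
  have "(\<Sum>i\<in>X. a i * real (s i t \<omega>)) = (\<Sum>i\<in>X. if s i t \<omega> = 1 then a i else 0)"
  proof (rule sum.cong)
    fix i assume "i \<in> X"
    then show "a i * real (s i t \<omega>) = (if s i t \<omega> = 1 then a i else 0)"
      using s_01[OF _ assms, of i t] by auto
  qed simp
  then show ?thesis
    using finite_agents by (simp add: awake_def sum.inter_filter)
qed

lemma activity_deviation:
  fixes a :: "nat \<Rightarrow> real" and \<epsilon> :: real
  assumes i: "i \<in> X" and T: "finite T" "T \<noteq> {}" and a: "\<And>t. t \<in> T \<Longrightarrow> \<bar>a t\<bar> \<le> 1" and "\<epsilon> \<ge> 0"
  shows "prob {\<omega> \<in> space M. (\<Sum>t\<in>T. a t * real (s i t \<omega>)) \<ge> (\<Sum>t\<in>T. a t * p i) + \<epsilon> * real (card T)}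
    \<le> exp (- (\<epsilon>\<^sup>2 / 2)) ^ card T"
proof -
  have [measurable]: "s i t \<in> measurable M (count_space UNIV)" for t using i by simp
  have "indep_vars (\<lambda>_. borel) (\<lambda>t \<omega>. a t * real (s i t \<omega>)) T"
    by (rule indep_vars_compose2[OF indep_vars_subset[OF s_indep[OF i], of T]]) auto
  moreover have "AE \<omega> in M. a t * real (s i t \<omega>) \<in> {-1..1}" if "t \<in> T" for t
  proof (rule AE_I2)
    fix \<omega> assume "\<omega> \<in> space M"
    then show "a t * real (s i t \<omega>) \<in> {-1..1}"
      using s_01[OF i, of \<omega> t] a[OF that] by (auto simp: abs_le_iff)
  qed
  ultimately interpret H: Hoeffding_ineq M T "\<lambda>t \<omega>. a t * real (s i t \<omega>)" "\<lambda>_. -1" "\<lambda>_. 1"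
    "\<Sum>t\<in>T. a t * p i"
    by unfold_locales (auto simp: T expectation_s[OF i])
  have pos: "card T > 0" using T by (simp add: card_gt_0_iff)
  then have "- 2 * (\<epsilon> * real (card T))\<^sup>2 / (\<Sum>t\<in>T. (1 - (-1::real))\<^sup>2) = real (card T) * - (\<epsilon>\<^sup>2 / 2)"
    by (simp add: field_simps power2_eq_square)
  then show ?thesis
    using H.Hoeffding_ineq_ge[of "\<epsilon> * real (card T)"] \<open>\<epsilon> \<ge> 0\<close> pos
    by (simp only: exp_of_nat_mult[symmetric]) simp
qed

text \<open>
  If the family of active sets seen on \<open>H\<close> is unbalanced at each time of \<open>T\<close>, a test vector for each of
  these times separates what happens on \<open>H\<close> from its expectation by \<open>\<delta>\<close>. Summed over \<open>T\<close> and
  distributed over the agents, on every path in \<open>H\<close> some agent must deviate by at least \<open>\<delta> * card T / card X\<close>.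
  For a single agent the weighted activities are independent over time, so Hoeffding's inequality
  applies, and a union bound over the agents takes the place of independence between them.
\<close>

lemma unbalanced_concentration:
  obtains r :: real where "0 < r" "r < 1"
    and "\<And>H T. H \<in> events \<Longrightarrow> finite T \<Longrightarrow> (\<And>t. t \<in> T \<Longrightarrow> \<not> balanced p X (awake t ` H))
      \<Longrightarrow> prob H \<le> real (card X) * r ^ card T"
proof -
  obtain \<delta> where \<delta>: "\<delta> > 0"
    "\<And>F. F \<subseteq> Pow X \<Longrightarrow> \<not> balanced p X F \<Longrightarrow>
      \<exists>a. (\<forall>i\<in>X. \<bar>a i\<bar> \<le> 1) \<and> (\<forall>B\<in>F. 0 \<le> sum a B) \<and> (\<Sum>i\<in>X. p i * a i) \<le> - \<delta>"
    using uniform_unbalance[OF finite_agents, of p] by blast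
  have nX: "card X > 0" using finite_agents agents_nonempty by (simp add: card_gt_0_iff)
  define \<epsilon> where "\<epsilon> = \<delta> / card X"
  have \<epsilon>: "\<epsilon> > 0" using \<delta> nX by (simp add: \<epsilon>_def)
  show ?thesis
  proof (rule that[of "exp (- (\<epsilon>\<^sup>2 / 2))"])
    show "exp (- (\<epsilon>\<^sup>2 / 2)) < 1" using \<epsilon> by simp
    fix H T assume H: "H \<in> events" and T: "finite T"
      and unb: "\<And>t. t \<in> T \<Longrightarrow> \<not> balanced p X (awake t ` H)"
    show "prob H \<le> real (card X) * exp (- (\<epsilon>\<^sup>2 / 2)) ^ card T"
    proof (cases "T = {}")
      case True
      have "prob H \<le> 1" by simp
      also have "1 \<le> real (card X)" using nX by simp
      finally show ?thesis using True by simp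
    next
      case False
      have "\<forall>t\<in>T. \<exists>a. (\<forall>i\<in>X. \<bar>a i\<bar> \<le> 1)
          \<and> (\<forall>B\<in>awake t ` H. 0 \<le> sum a B) \<and> (\<Sum>i\<in>X. p i * a i) \<le> - \<delta>"
        using unb awake_subset by (intro ballI \<delta>(2)) auto
      then obtain a where a': "\<forall>t\<in>T. (\<forall>i\<in>X. \<bar>a t i\<bar> \<le> 1)
          \<and> (\<forall>B\<in>awake t ` H. 0 \<le> sum (a t) B) \<and> (\<Sum>i\<in>X. p i * a t i) \<le> - \<delta>"
        unfolding bchoice_iff by blast
      have a: "\<And>t i. t \<in> T \<Longrightarrow> i \<in> X \<Longrightarrow> \<bar>a t i\<bar> \<le> 1"
        "\<And>t \<omega>. t \<in> T \<Longrightarrow> \<omega> \<in> H \<Longrightarrow> 0 \<le> sum (a t) (awake t \<omega>)"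
        "\<And>t. t \<in> T \<Longrightarrow> (\<Sum>i\<in>X. p i * a t i) \<le> - \<delta>"
        using a' by auto
      define D where "D i = {\<omega> \<in> space M.
        (\<Sum>t\<in>T. a t i * real (s i t \<omega>)) \<ge> (\<Sum>t\<in>T. a t i * p i) + \<epsilon> * real (card T)}" for i
      have D_event: "D i \<in> events" if "i \<in> X" for i
      proof -
        have [measurable]: "s i t \<in> measurable M (count_space UNIV)" for t using that by simp
        show ?thesis unfolding D_def by measurable
      qed
      have "H \<subseteq> (\<Union>i\<in>X. D i)"
      proof
        fix \<omega> assume \<omega>: "\<omega> \<in> H"
        then have sp: "\<omega> \<in> space M" using H sets.sets_into_space by blast
        show "\<omega> \<in> (\<Union>i\<in>X. D i)"
        proof (rule ccontr)
          assume "\<omega> \<notin> (\<Union>i\<in>X. D i)"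
          then have "(\<Sum>t\<in>T. a t i * real (s i t \<omega>)) < (\<Sum>t\<in>T. a t i * p i) + \<epsilon> * real (card T)" if "i \<in> X" for i
            using that sp by (auto simp: D_def not_le)
          then have "(\<Sum>i\<in>X. \<Sum>t\<in>T. a t i * real (s i t \<omega>))
              < (\<Sum>i\<in>X. (\<Sum>t\<in>T. a t i * p i) + \<epsilon> * real (card T))"
            using finite_agents agents_nonempty by (intro sum_strict_mono) auto
          also have "\<dots> = (\<Sum>t\<in>T. \<Sum>i\<in>X. p i * a t i) + \<delta> * real (card T)"
            using nX by (simp add: sum.distrib sum.swap[of _ X T] \<epsilon>_def mult.commute)
          also have "\<dots> \<le> (\<Sum>t\<in>T. - \<delta>) + \<delta> * real (card T)"
            using a(3) by (intro add_right_mono sum_mono) auto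
          also have "\<dots> = 0" by simp
          also have "(\<Sum>i\<in>X. \<Sum>t\<in>T. a t i * real (s i t \<omega>)) = (\<Sum>t\<in>T. sum (a t) (awake t \<omega>))"
            unfolding weighted_sum_awake[OF sp, symmetric] by (rule sum.swap)
          finally show False
            using a(2) \<omega> sum_nonneg[of T "\<lambda>t. sum (a t) (awake t \<omega>)"] by auto
        qed
      qed
      then have "prob H \<le> prob (\<Union>i\<in>X. D i)"
        using D_event finite_agents by (intro finite_measure_mono) auto
      also have "\<dots> \<le> (\<Sum>i\<in>X. prob (D i))"
        using D_event finite_agents by (intro finite_measure_subadditive_finite) auto
      also have "\<dots> \<le> (\<Sum>i\<in>X. exp (- (\<epsilon>\<^sup>2 / 2)) ^ card T)"
        unfolding D_def using T False a(1) \<epsilon> by (intro sum_mono activity_deviation) auto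
      finally show ?thesis by simp
    qed
  qed simp
qed

lemma awake_measurable [measurable]: "Measurable.pred M (\<lambda>\<omega>. awake t \<omega> = {})"
proof -
  have "(\<lambda>\<omega>. awake t \<omega> = {}) = (\<lambda>\<omega>. \<forall>i\<in>X. s i t \<omega> \<noteq> 1)"
    by (auto simp: awake_def)
  also have "Measurable.pred M \<dots>"
  proof (intro pred_intros_finite finite_agents)
    fix i assume "i \<in> X"
    then have [measurable]: "s i t \<in> measurable M (count_space UNIV)" by simp
    show "Measurable.pred M (\<lambda>\<omega>. s i t \<omega> \<noteq> 1)" by measurable
  qed
  finally show ?thesis .
qed

text \<open>
  On the event that nobody is active from time \<open>n\<close> on, the empty set is the only active set, and the
  family \<open>{{}}\<close> is unbalanced because all rates are positive. Concentration over ever longer time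
  windows makes this event null.
\<close>

lemma AE_infinitely_often_awake: "AE \<omega> in M. infinite {t. awake t \<omega> \<noteq> {}}"
proof -
  have null: "AE \<omega> in M. \<exists>t\<ge>n. awake t \<omega> \<noteq> {}" for n
  proof -
    define H where "H = {\<omega> \<in> space M. \<forall>t\<ge>n. awake t \<omega> = {}}"
    have H: "H \<in> events" unfolding H_def by measurable
    obtain r :: real where r: "0 < r" "r < 1" "\<And>H T. H \<in> events \<Longrightarrow> finite T \<Longrightarrow>
        (\<And>t. t \<in> T \<Longrightarrow> \<not> balanced p X (awake t ` H)) \<Longrightarrow> prob H \<le> real (card X) * r ^ card T"
      using unbalanced_concentration by blast
    have "\<not> balanced p X (awake t ` H)" if "t \<ge> n" for t
    proof -
      have "(\<Sum>i\<in>X. p i * (-1)) < 0"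
        using sum_pos[of X p] finite_agents agents_nonempty p_pos by (simp add: sum_negf)
      moreover have "\<forall>B\<in>awake t ` H. 0 \<le> (\<Sum>i\<in>B. -1::real)"
        using that by (auto simp: H_def)
      ultimately show ?thesis unfolding balanced_def not_all by (intro exI[of _ "\<lambda>_. -1"]) auto
    qed
    then have "prob H \<le> real (card X) * r ^ m" for m
      using r(3)[OF H, of "{n..<n+m}"] by simp
    moreover have "(\<lambda>m. real (card X) * r ^ m) \<longlonglongrightarrow> real (card X) * 0"
      using r by (intro tendsto_mult tendsto_const LIMSEQ_realpow_zero) auto
    ultimately have "prob H \<le> 0"
      using LIMSEQ_le_const[of _ "real (card X) * 0" "prob H"] by auto
    then have "prob H = 0" by (simp add: measure_le_0_iff)
    then show ?thesis
      by (intro AE_I[of _ _ H]) (auto simp: H_def H emeasure_eq_measure H[unfolded H_def])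
  qed
  then have "AE \<omega> in M. \<forall>n. \<exists>t\<ge>n. awake t \<omega> \<noteq> {}"
    by (simp add: AE_all_countable)
  then show ?thesis
    by (rule AE_mp) (auto simp: infinite_nat_iff_unbounded_le)
qed

end

section \<open>Exponential tails from bounded drift\<close>

text \<open>
  Sort the values of \<open>f\<close> into steps of width \<open>\<kappa>\<close> above \<open>b\<close>: the square grows quadratically in the
  number of the step while the measure of the step decays geometrically.
\<close>

lemma (in finite_measure) square_integrable_of_geometric_tail:
  fixes f :: "'a \<Rightarrow> real" and b \<kappa> C r :: real
  assumes [measurable]: "f \<in> borel_measurable M" and "\<And>\<omega>. \<omega> \<in> space M \<Longrightarrow> 0 \<le> f \<omega>"
    and "0 \<le> b" "0 < \<kappa>" "0 \<le> C" "0 \<le> r" "r < 1"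
    and tail: "\<And>m. measure M {\<omega> \<in> space M. b + \<kappa> * real m \<le> f \<omega>} \<le> C * r ^ m"
  shows "(\<integral>\<^sup>+\<omega>. ennreal ((f \<omega>)\<^sup>2) \<partial>M) < \<infinity>"
proof -
  define w where "w m = (b + \<kappa> * real (Suc m))\<^sup>2" for m :: nat
  define D where "D m = {\<omega> \<in> space M. b + \<kappa> * real m \<le> f \<omega>}" for m :: nat
  have [measurable]: "D m \<in> sets M" for m unfolding D_def by measurable
  have bound: "ennreal ((f \<omega>)\<^sup>2) \<le> ennreal (b\<^sup>2) + (\<Sum>m. ennreal (w m) * indicator (D m) \<omega>)"
    if \<omega>: "\<omega> \<in> space M" for \<omega>
  proof (cases "f \<omega> < b")
    case True
    then have "(f \<omega>)\<^sup>2 \<le> b\<^sup>2" using assms(2)[OF \<omega>] by (intro power_mono) auto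
    then show ?thesis by (intro order_trans[OF _ add_increasing2[OF _ order_refl]] ennreal_leI) auto
  next
    case False
    define m where "m = nat \<lfloor>(f \<omega> - b) / \<kappa>\<rfloor>"
    have "real m \<le> (f \<omega> - b) / \<kappa>" "(f \<omega> - b) / \<kappa> \<le> real (Suc m)"
      using False \<open>0 < \<kappa>\<close> by (auto simp: m_def) linarith
    then have m: "b + \<kappa> * real m \<le> f \<omega>" "f \<omega> \<le> b + \<kappa> * real (Suc m)"
      using \<open>0 < \<kappa>\<close> by (simp_all add: field_simps)
    have "(f \<omega>)\<^sup>2 \<le> w m"
      unfolding w_def using m assms(2)[OF \<omega>] by (intro power_mono) auto
    then have "ennreal ((f \<omega>)\<^sup>2) \<le> ennreal (w m) * indicator (D m) \<omega>"
      using m \<omega> by (auto simp: D_def intro: ennreal_leI)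
    also have "\<dots> \<le> (\<Sum>n. ennreal (w n) * indicator (D n) \<omega>)"
      using sum_le_suminf[of "\<lambda>n. ennreal (w n) * indicator (D n) \<omega>" "{m}"]
      by (simp del: sum_mult_indicator)
    finally show ?thesis by (intro add_increasing) auto
  qed
  have "(\<integral>\<^sup>+\<omega>. ennreal ((f \<omega>)\<^sup>2) \<partial>M)
      \<le> (\<integral>\<^sup>+\<omega>. ennreal (b\<^sup>2) + (\<Sum>m. ennreal (w m) * indicator (D m) \<omega>) \<partial>M)"
    by (intro nn_integral_mono bound)
  also have "\<dots> = ennreal (b\<^sup>2) * emeasure M (space M) + (\<Sum>m. ennreal (w m) * emeasure M (D m))"
    by (simp add: nn_integral_add nn_integral_suminf nn_integral_cmult_indicator)
  also have "\<dots> \<le> ennreal (b\<^sup>2) * emeasure M (space M) + (\<Sum>m. ennreal (w m * (C * r ^ m)))"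
  proof (intro add_left_mono suminf_le)
    fix m
    show "ennreal (w m) * emeasure M (D m) \<le> ennreal (w m * (C * r ^ m))"
      using tail[of m] by (auto simp: emeasure_eq_measure D_def w_def ennreal_mult'
          intro!: mult_left_mono ennreal_leI)
  qed auto
  also have "\<dots> < \<infinity>"
  proof -
    have "summable (\<lambda>m. w m * (C * r ^ m))"
    proof -
      \<comment> \<open>The twice differentiated geometric series has the coefficients \<open>(m + 1) * (m + 2)\<close>.\<close>
      have "summable (\<lambda>m. diffs (diffs (\<lambda>_. 1)) m * r ^ m)"
      proof (rule termdiff_converges[of r 1])
        fix z :: real assume "norm z < 1"
        then show "summable (\<lambda>m. diffs (\<lambda>_. 1) m * z ^ m)"
          by (intro termdiff_converges[of z 1]) (auto intro: summable_geometric)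
      qed (use assms in auto)
      then have "summable (\<lambda>m. ((b + \<kappa>)\<^sup>2 * C) * (diffs (diffs (\<lambda>_. 1)) m * r ^ m))"
        by (rule summable_mult)
      moreover have "norm (w m * (C * r ^ m)) \<le> ((b + \<kappa>)\<^sup>2 * C) * (diffs (diffs (\<lambda>_. 1)) m * r ^ m)" for m
      proof -
        have "w m \<le> ((b + \<kappa>) * real (Suc m))\<^sup>2"
          unfolding w_def using assms by (intro power_mono) (auto simp: algebra_simps)
        also have "\<dots> = (b + \<kappa>)\<^sup>2 * (real (Suc m) * real (Suc m))"
          by (simp add: power2_eq_square)
        also have "\<dots> \<le> (b + \<kappa>)\<^sup>2 * diffs (diffs (\<lambda>_. 1)) m"
          by (intro mult_left_mono) (auto simp: diffs_def intro!: mult_left_mono)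
        finally have "w m * (C * r ^ m) \<le> (b + \<kappa>)\<^sup>2 * diffs (diffs (\<lambda>_. 1)) m * (C * r ^ m)"
          using assms by (intro mult_right_mono) auto
        moreover have "0 \<le> w m * (C * r ^ m)" using assms by (simp add: w_def)
        ultimately show ?thesis by (simp add: mult_ac)
      qed
      ultimately show ?thesis by (rule summable_comparison_test'[where N = 0])
    qed
    then have "(\<Sum>m. ennreal (w m * (C * r ^ m))) = ennreal (\<Sum>m. w m * (C * r ^ m))"
      using assms by (intro suminf_ennreal2) (auto simp: w_def)
    then show ?thesis
      by (simp add: ennreal_mult_less_top emeasure_eq_measure)
  qed
  finally show ?thesis .
qed

context activity
begin

text \<open>
  Both levels are compared with the \<open>p\<close>-weighted mean of the signals at time \<open>t\<close>, so the paths
  of \<open>H\<close> and those of \<open>G\<close> need not share any active set.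
\<close>

lemma upper_level_linked:
  fixes y :: "nat \<Rightarrow> nat \<Rightarrow> real"
  assumes H: "\<And>\<omega>. \<omega> \<in> H \<Longrightarrow> awake t \<omega> \<noteq> {} \<Longrightarrow> L \<le> mean_over (awake t \<omega>) (\<lambda>i. y i t)"
    and G: "\<And>\<omega>. \<omega> \<in> G \<Longrightarrow> awake t \<omega> \<noteq> {} \<Longrightarrow> mean_over (awake t \<omega>) (\<lambda>i. y i t) \<le> U"
    and "balanced p X (awake t ` H)" "balanced p X (awake t ` G)"
  shows "L \<le> U"
proof -
  have "L * sum p X \<le> (\<Sum>i\<in>X. p i * y i t)"
    using assms by (intro balanced_mean_ge[OF finite_agents, of _ "awake t ` H"])
      (auto intro: subsetD[OF awake_subset])
  moreover have "(- U) * sum p X \<le> (\<Sum>i\<in>X. p i * (- y i t))"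
    using assms by (intro balanced_mean_ge[OF finite_agents, of _ "awake t ` G"])
      (auto simp: mean_over_minus intro: subsetD[OF awake_subset])
  ultimately have "L * sum p X \<le> U * sum p X" by (simp add: sum_negf)
  moreover have "sum p X > 0" using finite_agents agents_nonempty p_pos by (intro sum_pos) auto
  ultimately show ?thesis by simp
qed

text \<open>
  Compare the paths with large \<open>c\<close> to a reference set of positive probability on which \<open>c\<close> is bounded
  by \<open>l\<close>. Within a window of \<open>m\<close> times after \<open>T0\<close> the means move by at most \<open>\<nu> * m\<close> on either set, so a
  gap larger than \<open>2 * \<nu> * m\<close> persists, and at no time of the window can both families be balanced.
  Since the reference set has a fixed positive probability, its family is unbalanced at most \<open>k\<close> times
  with \<open>k\<close> independent of \<open>m\<close>. The other family is thus unbalanced at least \<open>m - k\<close> times. The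
  step width \<open>2 * \<nu> + 1\<close> is used in place of \<open>2 * \<nu>\<close> to be positive also for \<open>\<nu> = 0\<close>.
\<close>

lemma geometric_upper_tail:
  fixes y :: "nat \<Rightarrow> nat \<Rightarrow> real" and c :: "'w \<Rightarrow> real" and \<nu> :: real
  assumes [measurable]: "G \<in> events" "c \<in> borel_measurable M"
    and pos: "prob G > 0" and "0 \<le> \<nu>"
    and drift: "\<And>\<omega> t. \<omega> \<in> G \<Longrightarrow> T0 \<le> t \<Longrightarrow> awake t \<omega> \<noteq> {} \<Longrightarrow>
      \<bar>mean_over (awake t \<omega>) (\<lambda>i. y i t) - c \<omega>\<bar> \<le> \<nu> * real (t - T0)"
  obtains b C r :: real where "0 < b" "0 \<le> C" "0 < r" "r < 1"
    "\<And>m. prob {\<omega> \<in> G. b + (2 * \<nu> + 1) * real m \<le> c \<omega>} \<le> C * r ^ m"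
proof -
  obtain r :: real where r: "0 < r" "r < 1" and conc: "\<And>H T. H \<in> events \<Longrightarrow> finite T \<Longrightarrow>
      (\<And>t. t \<in> T \<Longrightarrow> \<not> balanced p X (awake t ` H)) \<Longrightarrow> prob H \<le> real (card X) * r ^ card T"
    using unbalanced_concentration by blast
  have sub: "\<omega> \<in> G \<Longrightarrow> \<omega> \<in> space M" for \<omega>
    using sets.sets_into_space[OF assms(1)] by blast
  define Low where "Low n = {\<omega> \<in> G. c \<omega> \<le> real n}" for n :: nat
  have Low_event: "Low n \<in> events" for n
  proof -
    have "Low n = G \<inter> {\<omega> \<in> space M. c \<omega> \<le> real n}" using sub by (auto simp: Low_def)
    then show ?thesis by simp
  qed
  obtain l where l: "prob (Low l) > 0"
  proof (rule ccontr)
    assume "\<not> thesis"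
    then have "prob (Low n) = 0" for n using that[of n] zero_less_measure_iff by blast
    \<comment> \<open>Otherwise the sets exhausting \<open>G\<close> would all be null.\<close>
    then have "emeasure M (\<Union>n. Low n) = 0"
      using Low_event by (intro emeasure_UN_eq_0) (auto simp: emeasure_eq_measure)
    moreover have "(\<Union>n. Low n) = G"
      by (auto simp: Low_def intro: real_arch_simple)
    ultimately show False using pos by (simp add: emeasure_eq_measure)
  qed
  obtain k where k: "real (card X) * r ^ k < prob (Low l)"
  proof -
    have "card X > 0" using finite_agents agents_nonempty by (simp add: card_gt_0_iff)
    then obtain k where "r ^ k < prob (Low l) / card X"
      using real_arch_pow_inv[of "prob (Low l) / card X" r] l r by auto
    then show ?thesis using \<open>card X > 0\<close> by (intro that[of k]) (simp add: field_simps)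
  qed
  have tail: "prob {\<omega> \<in> G. real l + 1 + (2 * \<nu> + 1) * real m \<le> c \<omega>} \<le> (real (card X) / r ^ k) * r ^ m" for m
  proof -
    define H where "H = {\<omega> \<in> G. real l + 1 + (2 * \<nu> + 1) * real m \<le> c \<omega>}"
    have "H = G \<inter> {\<omega> \<in> space M. real l + 1 + (2 * \<nu> + 1) * real m \<le> c \<omega>}"
      using sub by (auto simp: H_def)
    then have H_event: "H \<in> events" by simp
    define T where "T = {T0..<T0 + m}"
    define TL where "TL = {t \<in> T. \<not> balanced p X (awake t ` Low l)}"
    have fin: "finite T" "finite TL" by (simp_all add: T_def TL_def)
    have "card TL \<le> k"
    proof (rule ccontr)
      assume "\<not> card TL \<le> k"
      then have "r ^ card TL \<le> r ^ k" using r by (intro power_decreasing) auto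
      then have "real (card X) * r ^ card TL \<le> real (card X) * r ^ k" by (intro mult_left_mono) auto
      moreover have "prob (Low l) \<le> real (card X) * r ^ card TL"
        using fin by (intro conc Low_event) (auto simp: TL_def)
      ultimately show False using k by simp
    qed
    moreover have "card (T - TL) = m - card TL"
      using fin by (subst card_Diff_subset) (auto simp: TL_def T_def)
    ultimately have card: "m \<le> card (T - TL) + k" by simp
    have "\<not> balanced p X (awake t ` H)" if t: "t \<in> T - TL" for t
    proof
      assume bal: "balanced p X (awake t ` H)"
      have T0: "T0 \<le> t" and "real (t - T0) \<le> real m" using t by (auto simp: T_def)
      then have "\<nu> * real (t - T0) \<le> \<nu> * real m" using \<open>0 \<le> \<nu>\<close> by (intro mult_left_mono)
      then have dr: "\<bar>mean_over (awake t \<omega>) (\<lambda>i. y i t) - c \<omega>\<bar> \<le> \<nu> * real m"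
        if "\<omega> \<in> G" "awake t \<omega> \<noteq> {}" for \<omega>
        using drift[OF that(1) T0 that(2)] by simp
      have "real l + 1 + (2 * \<nu> + 1) * real m - \<nu> * real m \<le> real l + \<nu> * real m"
      proof (rule upper_level_linked[where H = H and G = "Low l"])
        fix \<omega> assume "\<omega> \<in> H" "awake t \<omega> \<noteq> {}"
        then show "real l + 1 + (2 * \<nu> + 1) * real m - \<nu> * real m \<le> mean_over (awake t \<omega>) (\<lambda>i. y i t)"
          using dr[of \<omega>] by (auto simp: H_def abs_le_iff)
      next
        fix \<omega> assume "\<omega> \<in> Low l" "awake t \<omega> \<noteq> {}"
        then show "mean_over (awake t \<omega>) (\<lambda>i. y i t) \<le> real l + \<nu> * real m"
          using dr[of \<omega>] by (auto simp: Low_def abs_le_iff)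
      qed (use bal t in \<open>auto simp: TL_def\<close>)
      then show False by (simp add: algebra_simps)
    qed
    then have "prob H \<le> real (card X) * r ^ card (T - TL)"
      using fin H_event by (intro conc) auto
    also have "r ^ card (T - TL) * r ^ k \<le> r ^ m"
      unfolding power_add[symmetric] using r card by (intro power_decreasing) auto
    then have "real (card X) * r ^ card (T - TL) \<le> (real (card X) / r ^ k) * r ^ m"
      using r by (simp add: field_simps mult_left_mono)
    finally show ?thesis by (simp add: H_def)
  qed
  show ?thesis
    by (rule that[OF _ _ r tail]) (use r in auto)
qed

lemma positive_part_square_integrable:
  fixes y :: "nat \<Rightarrow> nat \<Rightarrow> real" and c :: "'w \<Rightarrow> real" and \<nu> :: real
  assumes [measurable]: "G \<in> events" "c \<in> borel_measurable M"
    and "prob G > 0" "0 \<le> \<nu>"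
    and drift: "\<And>\<omega> t. \<omega> \<in> G \<Longrightarrow> T0 \<le> t \<Longrightarrow> awake t \<omega> \<noteq> {} \<Longrightarrow>
      \<bar>mean_over (awake t \<omega>) (\<lambda>i. y i t) - c \<omega>\<bar> \<le> \<nu> * real (t - T0)"
  shows "(\<integral>\<^sup>+\<omega>. ennreal ((indicator G \<omega> * max 0 (c \<omega>))\<^sup>2) \<partial>M) < \<infinity>"
proof -
  obtain b C r :: real where b: "0 < b" "0 \<le> C" "0 < r" "r < 1"
    and tail: "\<And>m. prob {\<omega> \<in> G. b + (2 * \<nu> + 1) * real m \<le> c \<omega>} \<le> C * r ^ m"
    using geometric_upper_tail[OF assms] by blast
  have "{\<omega> \<in> space M. b + (2 * \<nu> + 1) * real m \<le> indicator G \<omega> * max 0 (c \<omega>)}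
      = {\<omega> \<in> G. b + (2 * \<nu> + 1) * real m \<le> c \<omega>}" for m
  proof -
    have "0 < b + (2 * \<nu> + 1) * real m" using b \<open>0 \<le> \<nu>\<close> by (intro add_pos_nonneg) auto
    then show ?thesis
      using sets.sets_into_space[OF assms(1)] by (auto simp: indicator_def max_def split: if_splits)
  qed
  then show ?thesis
    using b tail \<open>0 \<le> \<nu>\<close>
    by (intro square_integrable_of_geometric_tail[of _ b "2 * \<nu> + 1" C r]) auto
qed

text \<open>
  The lower tail is the upper tail for the reflected signals \<open>- y\<close>.
\<close>

lemma square_integrable_of_drift:
  fixes y :: "nat \<Rightarrow> nat \<Rightarrow> real" and c :: "'w \<Rightarrow> real" and \<nu> :: real
  assumes [measurable]: "G \<in> events" "c \<in> borel_measurable M"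
    and "prob G > 0" "0 \<le> \<nu>"
    and drift: "\<And>\<omega> t. \<omega> \<in> G \<Longrightarrow> T0 \<le> t \<Longrightarrow> awake t \<omega> \<noteq> {} \<Longrightarrow>
      \<bar>mean_over (awake t \<omega>) (\<lambda>i. y i t) - c \<omega>\<bar> \<le> \<nu> * real (t - T0)"
  shows "(\<integral>\<^sup>+\<omega>. ennreal ((c \<omega>)\<^sup>2) * indicator G \<omega> \<partial>M) < \<infinity>"
proof -
  have "(\<integral>\<^sup>+\<omega>. ennreal ((indicator G \<omega> * max 0 (- c \<omega>))\<^sup>2) \<partial>M) < \<infinity>"
  proof (rule positive_part_square_integrable[where y = "\<lambda>i t. - y i t" and ?T0.0 = T0 and \<nu> = \<nu>])
    fix \<omega> t assume "\<omega> \<in> G" "T0 \<le> t" "awake t \<omega> \<noteq> {}"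
    from drift[OF this]
    show "\<bar>mean_over (awake t \<omega>) (\<lambda>i. - y i t) - - c \<omega>\<bar> \<le> \<nu> * real (t - T0)"
      by (simp add: mean_over_minus abs_le_iff)
  qed (use assms in auto)
  moreover have "(\<integral>\<^sup>+\<omega>. ennreal ((indicator G \<omega> * max 0 (c \<omega>))\<^sup>2) \<partial>M) < \<infinity>"
    using assms by (rule positive_part_square_integrable)
  moreover have "(\<integral>\<^sup>+\<omega>. ennreal ((c \<omega>)\<^sup>2) * indicator G \<omega> \<partial>M) =
      (\<integral>\<^sup>+\<omega>. ennreal ((indicator G \<omega> * max 0 (c \<omega>))\<^sup>2)
        + ennreal ((indicator G \<omega> * max 0 (- c \<omega>))\<^sup>2) \<partial>M)"
    by (intro nn_integral_cong) (auto simp: indicator_def max_def)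
  ultimately show ?thesis by (simp add: nn_integral_add)
qed

end

section \<open>Measurability and bounds for the estimate\<close>

lemma measurable_mean_over:
  fixes E :: "'a \<Rightarrow> nat set" and f :: "nat \<Rightarrow> 'a \<Rightarrow> real"
  assumes J: "finite J" "\<And>\<omega>. E \<omega> \<subseteq> J"
    and [measurable]: "\<And>i. i \<in> J \<Longrightarrow> Measurable.pred M (\<lambda>\<omega>. i \<in> E \<omega>)"
      "\<And>i. i \<in> J \<Longrightarrow> f i \<in> borel_measurable M"
  shows "(\<lambda>\<omega>. mean_over (E \<omega>) (\<lambda>i. f i \<omega>)) \<in> borel_measurable M"
proof -
  have eq: "sum h (E \<omega>) = (\<Sum>i\<in>J. if i \<in> E \<omega> then h i else 0)" for h :: "nat \<Rightarrow> real" and \<omega>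
    using J by (simp add: sum.inter_restrict[symmetric] Int_absorb1 Int_commute)
  have "real (card (E \<omega>)) = (\<Sum>i\<in>J. if i \<in> E \<omega> then 1 else 0)" for \<omega>
    using eq[of "\<lambda>_. 1" \<omega>] by simp
  then show ?thesis
    unfolding mean_over_def eq by simp
qed

lemma measurable_card_pos:
  assumes J: "finite J" "\<And>\<omega>. E \<omega> \<subseteq> J"
    and [measurable]: "\<And>i. i \<in> J \<Longrightarrow> Measurable.pred M (\<lambda>\<omega>. i \<in> E \<omega>)"
  shows "Measurable.pred M (\<lambda>\<omega>. 0 < card (E \<omega>))"
proof -
  have "0 < card (E \<omega>) \<longleftrightarrow> (\<exists>i\<in>J. i \<in> E \<omega>)" for \<omega>
    using finite_subset[OF J(2) J(1)] J(2)[of \<omega>] by (auto simp: card_gt_0_iff)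
  then show ?thesis
    using J(1) by simp
qed

lemma measurable_estimate:
  fixes E :: "'a \<Rightarrow> nat \<Rightarrow> nat set" and x :: "nat \<Rightarrow> nat \<Rightarrow> 'a \<Rightarrow> real"
  assumes J: "finite J" "\<And>\<omega> t. E \<omega> t \<subseteq> J"
    and E: "\<And>i t. i \<in> J \<Longrightarrow> Measurable.pred M (\<lambda>\<omega>. i \<in> E \<omega> t)"
    and x: "\<And>i t. i \<in> J \<Longrightarrow> x i t \<in> borel_measurable M"
  shows "(\<lambda>\<omega>. estimate (E \<omega>) (\<lambda>i u. x i u \<omega>) g x0 t) \<in> borel_measurable M"
proof (induction t)
  case (Suc t)
  have [measurable]: "Measurable.pred M (\<lambda>\<omega>. 0 < card (E \<omega> t))"
    by (rule measurable_card_pos[OF J(1)]) (use J E in auto)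
  have [measurable]: "(\<lambda>\<omega>. mean_over (E \<omega> t) (\<lambda>i. x i t \<omega>)) \<in> borel_measurable M"
    by (rule measurable_mean_over[OF J(1), where f = "\<lambda>i. x i t"]) (use J E x in auto)
  note Suc[measurable]
  show ?case by simp
qed simp

lemma measurable_active:
  assumes "\<And>i t. i \<in> {1..N} \<Longrightarrow> s i t \<in> measurable M (count_space UNIV)"
  shows "Measurable.pred M (\<lambda>\<omega>. i \<in> active N (\<lambda>i t. s i t \<omega>) t)"
proof (cases "i \<in> {1..N}")
  case True
  then have [measurable]: "s i t \<in> measurable M (count_space UNIV)" by (rule assms)
  show ?thesis using True by (simp add: active_def)
next
  case False
  then have "i \<notin> active N (\<lambda>i t. s i t \<omega>) t" for \<omega>
    unfolding active_def by blast
  then show ?thesis by simp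
qed

lemma measurable_est_set:
  assumes "\<And>i t. i \<in> {1..N} \<Longrightarrow> s i t \<in> measurable M (count_space UNIV)"
  shows "Measurable.pred M (\<lambda>\<omega>. i \<in> est_set N W k lam (\<lambda>i t. s i t \<omega>) R)"
proof (cases "i \<in> {1..N} \<and> R \<noteq> 0")
  case True
  then have [measurable]: "\<And>t. s i t \<in> measurable M (count_space UNIV)" using assms by auto
  have "k \<le> block_count W (\<lambda>i t. s i t \<omega>) i r \<longleftrightarrow> real k \<le> (\<Sum>u<W. real (s i ((r - 1) * W + u) \<omega>))" for \<omega> r
    unfolding block_count_def of_nat_sum[symmetric] by (simp only: of_nat_le_iff)
  then have [measurable]: "Measurable.pred M (\<lambda>\<omega>. k \<le> block_count W (\<lambda>i t. s i t \<omega>) i r)" for r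
    by (subst ext) measurable
  have [measurable]: "(\<lambda>\<omega>. score W k (\<lambda>i t. s i t \<omega>) i R) \<in> borel_measurable M"
    unfolding score_def block_pass_def by measurable
  have "i \<in> est_set N W k lam (\<lambda>i t. s i t \<omega>) R \<longleftrightarrow> lam \<le> score W k (\<lambda>i t. s i t \<omega>) i R" for \<omega>
    using True by (simp add: est_set_def)
  then show ?thesis by (subst ext) measurable
next
  case False
  then have "i \<notin> est_set N W k lam (\<lambda>i t. s i t \<omega>) R" for \<omega>
    unfolding est_set_def by (cases "R = 0") auto
  then show ?thesis by simp
qed

lemma measurable_eligible:
  assumes "\<And>i t. i \<in> {1..N} \<Longrightarrow> s i t \<in> measurable M (count_space UNIV)"
  shows "Measurable.pred M (\<lambda>\<omega>. i \<in> eligible N W k lam R0 (\<lambda>i t. s i t \<omega>) t)"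
proof -
  have "Measurable.pred M (\<lambda>\<omega>. i \<in> est_set N W k lam (\<lambda>i t. s i t \<omega>) R
      \<and> i \<in> active N (\<lambda>i t. s i t \<omega>) t)" for R
    by (intro pred_intros_logic measurable_est_set measurable_active assms)
  then show ?thesis
    by (cases "t < R0 * W") (simp_all only: eligible_def Int_iff if_True if_False)
qed

lemma measurable_first_informative_time:
  assumes J: "finite J" "\<And>\<omega> t. E \<omega> t \<subseteq> J"
    and E: "\<And>i t. i \<in> J \<Longrightarrow> Measurable.pred M (\<lambda>\<omega>. i \<in> E \<omega> t)"
  shows "(\<lambda>\<omega>. informative_time (E \<omega>) T0 T0) \<in> measurable M (count_space UNIV)"
proof -
  have "Measurable.pred M (\<lambda>\<omega>. T0 \<le> t \<and> 0 < card (E \<omega> t))" for t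
  proof (intro pred_intros_logic)
    show "Measurable.pred M (\<lambda>\<omega>. 0 < card (E \<omega> t))"
      by (rule measurable_card_pos[OF J(1,2) E])
  qed simp
  then show ?thesis
    unfolding informative_time_def informative_times_def enumerate_0 diff_self_eq_0 mem_Collect_eq
    by (rule measurable_Least)
qed

lemma abs_mean_over_le:
  assumes "finite J" "A \<subseteq> J"
  shows "\<bar>mean_over A f\<bar> \<le> (\<Sum>i\<in>J. \<bar>f i\<bar>)"
proof (cases "card A = 0")
  case True
  then show ?thesis by (simp add: mean_over_def sum_nonneg)
next
  case False
  have "\<bar>mean_over A f\<bar> = \<bar>sum f A\<bar> / card A" by (simp add: mean_over_def abs_mult)
  also have "\<dots> \<le> \<bar>sum f A\<bar> / 1"
    using False by (intro divide_left_mono) auto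
  also have "\<dots> = \<bar>sum f A\<bar>" by simp
  also have "\<dots> \<le> (\<Sum>i\<in>A. \<bar>f i\<bar>)" by (rule sum_abs)
  also have "\<dots> \<le> (\<Sum>i\<in>J. \<bar>f i\<bar>)" using assms by (intro sum_mono2) auto
  finally show ?thesis .
qed

text \<open>
  Each update is a convex combination, so the estimate never leaves an interval around 0 that
  contains the initial value and all means received so far.
\<close>

lemma abs_estimate_le:
  assumes J: "finite J" "\<And>t. E t \<subseteq> J" and g: "\<And>t. 0 \<le> g t \<and> g t \<le> 1"
  shows "\<bar>estimate E x g x0 t\<bar> \<le> \<bar>x0\<bar> + (\<Sum>u<t. \<Sum>i\<in>J. \<bar>x i u\<bar>)"
proof (induction t)
  case (Suc t)
  define b where "b = \<bar>x0\<bar> + (\<Sum>u<Suc t. \<Sum>i\<in>J. \<bar>x i u\<bar>)"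
  define v where "v = (if card (E t) > 0 then mean_over (E t) (\<lambda>i. x i t) else estimate E x g x0 t)"
  have est: "\<bar>estimate E x g x0 t\<bar> \<le> b"
    unfolding b_def by (rule order_trans[OF Suc]) (simp add: sum_nonneg)
  have "\<bar>mean_over (E t) (\<lambda>i. x i t)\<bar> \<le> b"
    unfolding b_def by (rule order_trans[OF abs_mean_over_le[OF J]]) (simp add: sum_nonneg)
  with est have "\<bar>v\<bar> \<le> b" by (simp add: v_def)
  with est have "estimate E x g x0 (Suc t) \<in> {-b..b}"
    using convexD[OF convex_real_interval(5)[of "-b" b], of "estimate E x g x0 t" v "1 - g t" "g t"] g[of t]
    by (auto simp: v_def abs_le_iff)
  then show ?case by (auto simp: b_def abs_le_iff)
qed simp

section \<open>The tracking error\<close>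

lemma est_set_eq_of_no_misclassification:
  assumes "misclassified N X W k lam s R = 0" "X \<subseteq> {1..N}" "R \<noteq> 0"
  shows "est_set N W k lam s R = X"
proof -
  have "\<forall>i\<in>{1..N}. score W k s i R \<ge> lam \<longleftrightarrow> i \<in> X"
    using assms(1) unfolding misclassified_def
    by (subst (asm) sum_nonneg_eq_0_iff) (auto split: if_splits)
  then have "{i \<in> {1..N}. lam \<le> score W k s i R} = {1..N} \<inter> X" by blast
  then show ?thesis using assms(2,3) by (simp add: est_set_def Int_absorb1)
qed

theorem theorem2:
  fixes M :: "'w measure"
    and N W k R0 T0 :: nat
    and X :: "nat set"
    and p :: "nat \<Rightarrow> real"
    and s :: "nat \<Rightarrow> nat \<Rightarrow> 'w \<Rightarrow> nat"
    and x :: "nat \<Rightarrow> nat \<Rightarrow> 'w \<Rightarrow> real"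
    and lam \<rho> \<eta> \<nu> x0 :: real
    and g :: "nat \<Rightarrow> real"
    and G :: "'w set"
    and E :: "'w \<Rightarrow> nat \<Rightarrow> nat set"
    and xhat xa e :: "nat \<Rightarrow> 'w \<Rightarrow> real"
  assumes "prob_space M"
    and "X \<subseteq> {1..N}" and "X \<noteq> {}"
    and "\<And>i. i \<in> {1..N} \<Longrightarrow> 0 < p i \<and> p i \<le> 1"
    and "\<And>i t \<omega>. i \<in> {1..N} \<Longrightarrow> \<omega> \<in> space M \<Longrightarrow> s i t \<omega> \<in> {0, 1}"
    and "\<And>i. i \<in> {1..N} \<Longrightarrow> prob_space.indep_vars M (\<lambda>_. count_space UNIV) (s i) UNIV"
    and "\<And>i t. i \<in> {1..N} \<Longrightarrow> measure M {\<omega> \<in> space M. s i t \<omega> = 1} = p i"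
    and "\<And>i t. i \<in> {1..N} \<Longrightarrow> x i t \<in> borel_measurable M"
    and "W \<ge> 1" and "k \<in> {1..W}" and "0 < lam" and "lam < 1"
    and "0 < \<rho>" and "\<rho> < 1" and "R0 \<ge> 1" and "T0 = R0 * W"
    and "\<And>t. 0 < g t \<and> g t \<le> 1"
    and "0 < \<eta>" and "\<eta> \<le> 1" and "\<And>t. t \<ge> T0 \<Longrightarrow> g t = \<eta>"
    and G_eq: "G = {\<omega> \<in> space M. misclassified N X W k lam (\<lambda>i t. s i t \<omega>) R0 = 0}"
    and E_eq: "E = (\<lambda>\<omega>. eligible N W k lam R0 (\<lambda>i t. s i t \<omega>))"
    and xhat_eq: "xhat = (\<lambda>t \<omega>.
          estimate (E \<omega>) (\<lambda>i u. x i u \<omega>) g x0 (informative_time (E \<omega>) T0 t))"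
    and xa_eq: "xa = (\<lambda>t \<omega>. let u = informative_time (E \<omega>) T0 t in
          mean_over (X \<inter> active N (\<lambda>i t. s i t \<omega>) u) (\<lambda>i. x i u \<omega>))"
    and e_eq: "e = (\<lambda>t \<omega>. xhat t \<omega> - xa t \<omega>)"
    and "measure M G \<ge> 1 - \<rho>"
    and "\<nu> \<ge> 0"
    and drift: "\<And>\<omega> t. \<omega> \<in> G \<Longrightarrow> t \<ge> T0 \<Longrightarrow> has_label (E \<omega>) T0 (t + 1) \<Longrightarrow>
          \<bar>xa (t + 1) \<omega> - xa t \<omega>\<bar> \<le> \<nu>"
  shows "(\<forall>\<omega>\<in>G. \<forall>t\<ge>T0. has_label (E \<omega>) T0 (t + 1) \<longrightarrow>
            \<bar>e (t + 1) \<omega>\<bar>\<^sup>2 \<le> (1 - \<eta>) * \<bar>e t \<omega>\<bar>\<^sup>2 + \<nu>\<^sup>2 / \<eta>)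
       \<and> ((\<forall>i\<in>{1..N}. \<forall>t. x i t constant_on space M)
            \<or> (\<integral>\<^sup>+\<omega>. ennreal (\<bar>e T0 \<omega>\<bar>\<^sup>2) \<partial>uniform_measure M G) < \<infinity>
          \<longrightarrow> limsup (\<lambda>t. \<integral>\<^sup>+\<omega>. ennreal (\<bar>e t \<omega>\<bar>\<^sup>2) \<partial>uniform_measure M G) \<le> ennreal (\<nu>\<^sup>2 / \<eta>\<^sup>2))"
proof -
  interpret prob_space M by fact
  have s_meas: "s i t \<in> measurable M (count_space UNIV)" if "i \<in> {1..N}" for i t
    using assms(6)[OF that] unfolding indep_vars_def by auto
  interpret activity M X p s
  proof
    show "finite X" using assms(2) finite_subset by blast
    show "s i t \<omega> \<in> {0, 1}" if "i \<in> X" "\<omega> \<in> space M" for i t \<omega>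
      using assms(2,5) that by blast
  qed (use assms(2,3,4,6,7) in auto)
  have prob_G: "prob G > 0" using assms(14) \<open>measure M G \<ge> 1 - \<rho>\<close> by simp
  then have G_event: "G \<in> events" using measure_notin_sets[of G M] by fastforce
  have G_space: "\<omega> \<in> space M" if "\<omega> \<in> G" for \<omega> using that by (simp add: G_eq)
  have awake_eq: "X \<inter> active N (\<lambda>i t. s i t \<omega>) t = awake t \<omega>" for t \<omega>
    using assms(2) by (auto simp: active_def awake_def)
  have E_sub: "E \<omega> t \<subseteq> {1..N}" for \<omega> t
    by (auto simp: E_eq eligible_def active_def)
  have E_awake: "E \<omega> t = awake t \<omega>" if "\<omega> \<in> G" "T0 \<le> t" for \<omega> t
  proof -
    have "est_set N W k lam (\<lambda>i t. s i t \<omega>) R0 = X"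
      using that(1) assms(2) \<open>R0 \<ge> 1\<close>
      by (intro est_set_eq_of_no_misclassification) (auto simp: G_eq)
    then show ?thesis
      using that(2) by (simp add: E_eq eligible_def \<open>T0 = R0 * W\<close> awake_eq)
  qed
  define u where "u t \<omega> = informative_time (E \<omega>) T0 t" for t \<omega>
  have xa: "xa t \<omega> = mean_over (awake (u t \<omega>) \<omega>) (\<lambda>i. x i (u t \<omega>) \<omega>)" for t \<omega>
    by (simp add: xa_eq u_def Let_def awake_eq)
  have u_ge: "T0 \<le> u t \<omega>" if "has_label (E \<omega>) T0 t" for t \<omega>
    using informative_time_in[OF that] by (simp add: u_def informative_times_def)
  have e_step: "e (t + 1) \<omega> = (1 - \<eta>) * e t \<omega> - (xa (t + 1) \<omega> - xa t \<omega>)"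
    if "\<omega> \<in> G" "T0 \<le> t" "has_label (E \<omega>) T0 (t + 1)" for \<omega> t
  proof -
    have "T0 \<le> u t \<omega>" by (rule u_ge[OF has_label_pred[OF that(3,2)]])
    then have "xhat (t + 1) \<omega> = (1 - \<eta>) * xhat t \<omega> + \<eta> * xa t \<omega>"
      using estimate_next_informative[OF that(2,3), of "\<lambda>i u. x i u \<omega>" g x0]
        assms(20)[of "u t \<omega>"] E_awake[OF that(1)]
      by (simp add: xhat_eq u_def[symmetric] xa)
    then show ?thesis by (simp add: e_eq algebra_simps)
  qed
  have contraction: "\<bar>e (t + 1) \<omega>\<bar>\<^sup>2 \<le> (1 - \<eta>) * \<bar>e t \<omega>\<bar>\<^sup>2 + \<nu>\<^sup>2 / \<eta>"
    if "\<omega> \<in> G" "T0 \<le> t" "has_label (E \<omega>) T0 (t + 1)" for \<omega> t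
    unfolding e_step[OF that]
    using \<open>0 < \<eta>\<close> \<open>\<eta> \<le> 1\<close> drift[OF that] by (rule square_contraction_with_drift)

  have E_meas: "Measurable.pred M (\<lambda>\<omega>. i \<in> E \<omega> t)" for i t
    unfolding E_eq by (intro measurable_eligible s_meas)
  have u_meas: "u T0 \<in> measurable M (count_space UNIV)"
    unfolding u_def by (rule measurable_first_informative_time[OF _ E_sub E_meas]) simp
  have xhat_meas: "xhat T0 \<in> borel_measurable M"
    unfolding xhat_eq u_def[symmetric]
    by (rule measurable_compose_countable[OF measurable_estimate[OF _ E_sub E_meas assms(8)] u_meas]) simp
  have xa_meas: "xa T0 \<in> borel_measurable M"
  proof -
    have mean_meas: "(\<lambda>\<omega>. mean_over (awake t \<omega>) (\<lambda>i. x i t \<omega>)) \<in> borel_measurable M" for t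
    proof (rule measurable_mean_over[OF finite_agents awake_subset])
      fix i assume "i \<in> X"
      then have i: "i \<in> {1..N}" using assms(2) by blast
      have eq: "(\<lambda>\<omega>. i \<in> awake t \<omega>) = (\<lambda>\<omega>. i \<in> active N (\<lambda>i t. s i t \<omega>) t)"
        using \<open>i \<in> X\<close> by (simp add: awake_eq[symmetric])
      show "Measurable.pred M (\<lambda>\<omega>. i \<in> awake t \<omega>)"
        unfolding eq by (rule measurable_active[OF s_meas])
      show "x i t \<in> borel_measurable M" using i by (rule assms(8))
    qed
    have "xa T0 = (\<lambda>\<omega>. mean_over (awake (u T0 \<omega>) \<omega>) (\<lambda>i. x i (u T0 \<omega>) \<omega>))"
      by (rule ext) (rule xa)
    then show ?thesis
      using measurable_compose_countable[where f = "\<lambda>t \<omega>. mean_over (awake t \<omega>) (\<lambda>i. x i t \<omega>)",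
        OF mean_meas u_meas] by (simp only:)
  qed

  \<comment> \<open>At most \<open>v - T0\<close> labels separate the first informative time from the informative time \<open>v\<close>.\<close>
  have drift_from_start: "\<bar>mean_over (awake v \<omega>) (\<lambda>i. x i v \<omega>) - xa T0 \<omega>\<bar> \<le> \<nu> * real (v - T0)"
    if \<omega>: "\<omega> \<in> G" and v: "T0 \<le> v" "awake v \<omega> \<noteq> {}" for \<omega> v
  proof -
    have "v \<in> informative_times (E \<omega>) T0"
      using v E_awake[OF \<omega>] finite_subset[OF awake_subset finite_agents]
      by (simp add: informative_times_def card_gt_0_iff)
    then obtain t where t: "has_label (E \<omega>) T0 t" "u t \<omega> = v"
      unfolding u_def by (rule informative_time_label)
    have "T0 \<le> t" using t(1) by (simp add: has_label_def)
    then have "\<bar>xa t \<omega> - xa T0 \<omega>\<bar> \<le> \<nu> * real (t - T0)"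
      using t(1)
    proof (induction t rule: dec_induct)
      case (step n)
      have "\<bar>xa (n + 1) \<omega> - xa n \<omega>\<bar> \<le> \<nu>" using step by (intro drift \<omega>) auto
      moreover have "\<bar>xa n \<omega> - xa T0 \<omega>\<bar> \<le> \<nu> * real (n - T0)"
        using step has_label_pred[of "E \<omega>" T0 n] by simp
      moreover have "real (Suc n - T0) = real (n - T0) + 1"
        using step.hyps by (simp add: Suc_diff_le)
      ultimately show ?case by (simp add: algebra_simps)
    qed simp
    also have "\<nu> * real (t - T0) \<le> \<nu> * real (v - T0)"
      using le_informative_time[OF t(1)] t(2) \<open>\<nu> \<ge> 0\<close> by (intro mult_left_mono) (auto simp: u_def)
    finally show ?thesis by (simp add: xa t(2))
  qed

  define P where "P = uniform_measure M G"
  have emeasure_G: "emeasure M G \<noteq> 0" using prob_G by (simp add: emeasure_eq_measure)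
  interpret P: prob_space P
    unfolding P_def using emeasure_G by (intro prob_space_uniform_measure) auto
  \<comment> \<open>Almost surely given \<open>G\<close> no label is void, so the contraction can be iterated forever.\<close>
  have all_labels: "AE \<omega> in P. \<omega> \<in> G \<and> (\<forall>t\<ge>T0. has_label (E \<omega>) T0 t)"
    unfolding P_def
  proof (rule AE_uniform_measureI[OF G_event], rule AE_mp[OF AE_infinitely_often_awake],
      rule AE_I2, intro impI conjI)
    fix \<omega> assume inf: "infinite {t. awake t \<omega> \<noteq> {}}" and \<omega>: "\<omega> \<in> G"
    have "{t. awake t \<omega> \<noteq> {}} \<subseteq> {..<T0} \<union> informative_times (E \<omega>) T0"
      using E_awake[OF \<omega>] finite_subset[OF awake_subset finite_agents]
      by (auto simp: informative_times_def card_gt_0_iff)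
    with inf have "infinite (informative_times (E \<omega>) T0)"
      using finite_subset by blast
    then show "\<forall>t\<ge>T0. has_label (E \<omega>) T0 t" by (simp add: has_label_def)
  qed
  have meas_P: "f \<in> borel_measurable P \<longleftrightarrow> f \<in> borel_measurable M" for f :: "'w \<Rightarrow> real"
    unfolding P_def by (simp add: measurable_def)

  \<comment> \<open>The estimate at the first informative time is still the one at \<open>T0\<close>, which is bounded when the
    signals are deterministic; the target has a second moment by its exponential tails.\<close>
  have initial_error: "(\<integral>\<^sup>+\<omega>. ennreal (\<bar>e T0 \<omega>\<bar>\<^sup>2) \<partial>P) < \<infinity>"
    if "\<forall>i\<in>{1..N}. \<forall>t. x i t constant_on space M"
  proof -
    from that obtain y where y: "\<And>i t \<omega>. i \<in> {1..N} \<Longrightarrow> \<omega> \<in> space M \<Longrightarrow> x i t \<omega> = y i t"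
      unfolding constant_on_def by metis
    define b where "b = \<bar>x0\<bar> + (\<Sum>v<T0. \<Sum>i\<in>{1..N}. \<bar>y i v\<bar>)"
    have "(\<integral>\<^sup>+\<omega>. ennreal ((xa T0 \<omega>)\<^sup>2) * indicator G \<omega> \<partial>M) < \<infinity>"
    proof (rule square_integrable_of_drift[OF G_event xa_meas prob_G \<open>\<nu> \<ge> 0\<close>, where y = y and ?T0.0 = T0])
      fix \<omega> t assume A: "\<omega> \<in> G" "T0 \<le> t" "awake t \<omega> \<noteq> {}"
      have "mean_over (awake t \<omega>) (\<lambda>i. x i t \<omega>) = mean_over (awake t \<omega>) (\<lambda>i. y i t)"
        unfolding mean_over_def using y[OF _ G_space[OF A(1)]] awake_subset[of t \<omega>] assms(2)
        by (intro arg_cong2[where f = "(*)"] sum.cong) blast+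
      then show "\<bar>mean_over (awake t \<omega>) (\<lambda>i. y i t) - xa T0 \<omega>\<bar> \<le> \<nu> * real (t - T0)"
        using drift_from_start[OF A] by simp
    qed
    moreover have "(\<integral>\<^sup>+\<omega>. ennreal ((xa T0 \<omega>)\<^sup>2) \<partial>P)
        = (\<integral>\<^sup>+\<omega>. ennreal ((xa T0 \<omega>)\<^sup>2) * indicator G \<omega> \<partial>M) / emeasure M G"
      unfolding P_def using xa_meas G_event by (intro nn_integral_uniform_measure) simp_all
    ultimately have xa_fin: "(\<integral>\<^sup>+\<omega>. ennreal ((xa T0 \<omega>)\<^sup>2) \<partial>P) < \<infinity>"
      using emeasure_G by (simp add: ennreal_divide_eq_top_iff less_top[symmetric])
    have "AE \<omega> in P. ennreal (\<bar>e T0 \<omega>\<bar>\<^sup>2) \<le> ennreal (2 * b\<^sup>2) + 2 * ennreal ((xa T0 \<omega>)\<^sup>2)"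
    proof (rule AE_mp[OF all_labels], rule AE_I2, rule impI)
      fix \<omega> assume "\<omega> \<in> G \<and> (\<forall>t\<ge>T0. has_label (E \<omega>) T0 t)"
      then have \<omega>: "\<omega> \<in> G" "has_label (E \<omega>) T0 T0" by auto
      have "xhat T0 \<omega> = estimate (E \<omega>) (\<lambda>i u. x i u \<omega>) g x0 T0"
        using estimate_first_informative[OF \<omega>(2)] by (simp add: xhat_eq)
      also have "\<bar>\<dots>\<bar> \<le> \<bar>x0\<bar> + (\<Sum>v<T0. \<Sum>i\<in>{1..N}. \<bar>x i v \<omega>\<bar>)"
        using assms(17) by (intro abs_estimate_le E_sub) (auto simp: less_imp_le)
      also have "\<dots> = b"
        unfolding b_def using y[OF _ G_space[OF \<omega>(1)]]
        by (intro arg_cong2[where f = "(+)"] sum.cong refl) simp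
      finally have "(xhat T0 \<omega>)\<^sup>2 \<le> b\<^sup>2" by (simp add: abs_le_square_iff[symmetric])
      \<comment> \<open>The parallelogram identity bounds the square of the difference.\<close>
      moreover have "(e T0 \<omega>)\<^sup>2 + (xhat T0 \<omega> + xa T0 \<omega>)\<^sup>2 = 2 * (xhat T0 \<omega>)\<^sup>2 + 2 * (xa T0 \<omega>)\<^sup>2"
        by (simp add: e_eq power2_eq_square algebra_simps)
      ultimately have "(e T0 \<omega>)\<^sup>2 \<le> 2 * b\<^sup>2 + 2 * (xa T0 \<omega>)\<^sup>2"
        using zero_le_power2[of "xhat T0 \<omega> + xa T0 \<omega>"] by linarith
      then have "ennreal (\<bar>e T0 \<omega>\<bar>\<^sup>2) \<le> ennreal (2 * b\<^sup>2 + 2 * (xa T0 \<omega>)\<^sup>2)"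
        by (intro ennreal_leI) simp
      also have "\<dots> = ennreal (2 * b\<^sup>2) + 2 * ennreal ((xa T0 \<omega>)\<^sup>2)"
        by (simp add: ennreal_mult)
      finally show "ennreal (\<bar>e T0 \<omega>\<bar>\<^sup>2) \<le> ennreal (2 * b\<^sup>2) + 2 * ennreal ((xa T0 \<omega>)\<^sup>2)" .
    qed
    then have "(\<integral>\<^sup>+\<omega>. ennreal (\<bar>e T0 \<omega>\<bar>\<^sup>2) \<partial>P)
        \<le> (\<integral>\<^sup>+\<omega>. ennreal (2 * b\<^sup>2) + 2 * ennreal ((xa T0 \<omega>)\<^sup>2) \<partial>P)"
      by (rule nn_integral_mono_AE)
    also have "\<dots> = ennreal (2 * b\<^sup>2) + 2 * (\<integral>\<^sup>+\<omega>. ennreal ((xa T0 \<omega>)\<^sup>2) \<partial>P)"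
    proof -
      have [measurable]: "xa T0 \<in> borel_measurable P" using xa_meas by (simp only: meas_P)
      show ?thesis by (simp add: nn_integral_add nn_integral_cmult P.emeasure_space_1)
    qed
    also have "\<dots> < \<infinity>" using xa_fin by (simp add: ennreal_mult_less_top)
    finally show ?thesis .
  qed

  have limit: "limsup (\<lambda>t. \<integral>\<^sup>+\<omega>. ennreal (\<bar>e t \<omega>\<bar>\<^sup>2) \<partial>P) \<le> ennreal (\<nu>\<^sup>2 / \<eta>\<^sup>2)"
    if fin: "(\<integral>\<^sup>+\<omega>. ennreal (\<bar>e T0 \<omega>\<bar>\<^sup>2) \<partial>P) < \<infinity>"
  proof -
    have "limsup (\<lambda>n. \<integral>\<^sup>+\<omega>. ennreal (\<bar>e (n + T0) \<omega>\<bar>\<^sup>2) \<partial>P) \<le> ennreal (\<nu>\<^sup>2 / \<eta>\<^sup>2)"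
    proof (rule P.limsup_of_contraction[OF \<open>0 < \<eta>\<close> \<open>\<eta> \<le> 1\<close>])
      have "e T0 \<in> borel_measurable P"
        unfolding meas_P e_eq using xhat_meas xa_meas by (rule borel_measurable_diff)
      then show "(\<lambda>\<omega>. \<bar>e (0 + T0) \<omega>\<bar>\<^sup>2) \<in> borel_measurable P" by simp
      show "AE \<omega> in P. \<forall>n. \<bar>e (Suc n + T0) \<omega>\<bar>\<^sup>2 \<le> (1 - \<eta>) * \<bar>e (n + T0) \<omega>\<bar>\<^sup>2 + \<eta> * (\<nu>\<^sup>2 / \<eta>\<^sup>2)"
      proof (rule AE_mp[OF all_labels], rule AE_I2, intro impI allI)
        fix \<omega> n assume "\<omega> \<in> G \<and> (\<forall>t\<ge>T0. has_label (E \<omega>) T0 t)"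
        then have "\<bar>e (n + T0 + 1) \<omega>\<bar>\<^sup>2 \<le> (1 - \<eta>) * \<bar>e (n + T0) \<omega>\<bar>\<^sup>2 + \<nu>\<^sup>2 / \<eta>"
          by (intro contraction) auto
        moreover have "\<eta> * (\<nu>\<^sup>2 / \<eta>\<^sup>2) = \<nu>\<^sup>2 / \<eta>" using \<open>0 < \<eta>\<close> by (simp add: power2_eq_square)
        ultimately show "\<bar>e (Suc n + T0) \<omega>\<bar>\<^sup>2 \<le> (1 - \<eta>) * \<bar>e (n + T0) \<omega>\<bar>\<^sup>2 + \<eta> * (\<nu>\<^sup>2 / \<eta>\<^sup>2)"
          by simp
      qed
    qed (use fin in auto)
    then show ?thesis
      by (simp only: limsup_shift_k[of "\<lambda>t. \<integral>\<^sup>+\<omega>. ennreal (\<bar>e t \<omega>\<bar>\<^sup>2) \<partial>P"])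
  qed

  show ?thesis
    using contraction initial_error limit unfolding P_def by blast
qed

end
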